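(* The category $\mathrm{Sym}$ of symmetric simplicial sets is universal, i.e. for every group $H$ there exists a symmetric simplicial set $X$ such that $\operatorname{Aut}_{\mathrm{Sym}}(X)\cong H$. Moreover, given an abstract group $H$ there exist infinitely many pairwise non-isomorphic symmetric simplicial sets $X$ such that $\operatorname{Aut}_{\mathrm{Sym}}(X)\cong H$.
   Context: A symmetric simplicial set is a contravariant functor to sets from the category whose objects are the finite sets $[n]=\{0,1,\dots,n\}$, $n\ge 0$, and whose morphisms are all maps of sets (not necessarily order preserving). $\mathrm{Sym}$ is the category of symmetric simplicial sets and natural transformations; $\operatorname{Aut}_{\mathrm{Sym}}(X)$ is the group of automorphisms of $X$ in this category. A category $\mathcal{C}$ is universal if for every group $H$ there is an object $X$ of $\mathcal{C}$ with $\operatorname{Aut}_{\mathcal{C}}(X)\cong H$. *)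

theory Defs
  imports "HOL-Algebra.Group"
begin

text \<open>The object \<open>[n] = {0, \<dots>, n}\<close> is \<open>{..n}\<close>. A morphism \<open>[m] \<rightarrow> [n]\<close> is an arbitrary map, represented
  by its extensional version, so that equality of morphisms is equality on \<open>{..m}\<close>.\<close>

abbreviation fin_map :: "nat \<Rightarrow> nat \<Rightarrow> (nat \<Rightarrow> nat) set" where
  "fin_map m n \<equiv> {..m} \<rightarrow>\<^sub>E {..n}"

text \<open>\<open>act X m n f\<close> is the map \<open>X f : X [n] \<rightarrow> X [m]\<close> induced by \<open>f : [m] \<rightarrow> [n]\<close>; source and target are
  arguments because \<open>f\<close> alone does not determine its codomain.\<close>

record 'x sym_sset =
  simplices :: "nat \<Rightarrow> 'x set"
  act :: "nat \<Rightarrow> nat \<Rightarrow> (nat \<Rightarrow> nat) \<Rightarrow> 'x \<Rightarrow> 'x"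

locale symmetric_simplicial_set =
  fixes X :: "'x sym_sset"
  assumes act_closed:
      "f \<in> fin_map m n \<Longrightarrow> x \<in> simplices X n \<Longrightarrow> act X m n f x \<in> simplices X m"
    and act_id:
      "x \<in> simplices X n \<Longrightarrow> act X n n (\<lambda>i\<in>{..n}. i) x = x"
    and act_comp:
      "f \<in> fin_map k m \<Longrightarrow> g \<in> fin_map m n \<Longrightarrow> x \<in> simplices X n \<Longrightarrow>
        act X k n (compose {..k} g f) x = act X k m f (act X m n g x)"

text \<open>Natural transformations; components are extensional so that equality is componentwise equality
  on simplices.\<close>

definition sym_hom :: "'x sym_sset \<Rightarrow> 'y sym_sset \<Rightarrow> (nat \<Rightarrow> 'x \<Rightarrow> 'y) set" where
  "sym_hom X Y = {\<alpha>. (\<forall>n. \<alpha> n \<in> simplices X n \<rightarrow>\<^sub>E simplices Y n) \<and>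
     (\<forall>m n. \<forall>f\<in>fin_map m n. \<forall>x\<in>simplices X n.
        \<alpha> m (act X m n f x) = act Y m n f (\<alpha> n x))}"

definition sym_id :: "'x sym_sset \<Rightarrow> nat \<Rightarrow> 'x \<Rightarrow> 'x" where
  "sym_id X = (\<lambda>n. \<lambda>x\<in>simplices X n. x)"

definition sym_comp ::
    "'x sym_sset \<Rightarrow> (nat \<Rightarrow> 'y \<Rightarrow> 'z) \<Rightarrow> (nat \<Rightarrow> 'x \<Rightarrow> 'y) \<Rightarrow> nat \<Rightarrow> 'x \<Rightarrow> 'z" where
  "sym_comp X \<beta> \<alpha> = (\<lambda>n. compose (simplices X n) (\<beta> n) (\<alpha> n))"

definition sym_isomorphic :: "'x sym_sset \<Rightarrow> 'y sym_sset \<Rightarrow> bool" where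
  "sym_isomorphic X Y \<longleftrightarrow> (\<exists>\<alpha>\<in>sym_hom X Y. \<exists>\<beta>\<in>sym_hom Y X.
     sym_comp X \<beta> \<alpha> = sym_id X \<and> sym_comp Y \<alpha> \<beta> = sym_id Y)"

definition End_Sym :: "'x sym_sset \<Rightarrow> (nat \<Rightarrow> 'x \<Rightarrow> 'x) monoid" where
  "End_Sym X = \<lparr>carrier = sym_hom X X, monoid.mult = sym_comp X, one = sym_id X\<rparr>"

definition Aut_Sym :: "'x sym_sset \<Rightarrow> (nat \<Rightarrow> 'x \<Rightarrow> 'x) monoid" where
  "Aut_Sym X = units_of (End_Sym X)"

context symmetric_simplicial_set
begin

lemma monoid_End_Sym: "monoid (End_Sym X)"
proof (rule monoidI)
  fix \<alpha> \<beta> assume "\<alpha> \<in> carrier (End_Sym X)" "\<beta> \<in> carrier (End_Sym X)"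
  then show "\<alpha> \<otimes>\<^bsub>End_Sym X\<^esub> \<beta> \<in> carrier (End_Sym X)"
    using act_closed
    by (auto simp: End_Sym_def sym_hom_def sym_comp_def compose_def PiE_iff)
next
  show "\<one>\<^bsub>End_Sym X\<^esub> \<in> carrier (End_Sym X)"
    using act_closed by (auto simp: End_Sym_def sym_hom_def sym_id_def)
next
  fix \<alpha> \<beta> \<gamma>
  assume "\<alpha> \<in> carrier (End_Sym X)" "\<beta> \<in> carrier (End_Sym X)" "\<gamma> \<in> carrier (End_Sym X)"
  then show "\<alpha> \<otimes>\<^bsub>End_Sym X\<^esub> \<beta> \<otimes>\<^bsub>End_Sym X\<^esub> \<gamma> = \<alpha> \<otimes>\<^bsub>End_Sym X\<^esub> (\<beta> \<otimes>\<^bsub>End_Sym X\<^esub> \<gamma>)"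
    by (auto simp: End_Sym_def sym_hom_def sym_comp_def compose_def PiE_iff fun_eq_iff)
next
  fix \<alpha> assume "\<alpha> \<in> carrier (End_Sym X)"
  then show "\<one>\<^bsub>End_Sym X\<^esub> \<otimes>\<^bsub>End_Sym X\<^esub> \<alpha> = \<alpha>" "\<alpha> \<otimes>\<^bsub>End_Sym X\<^esub> \<one>\<^bsub>End_Sym X\<^esub> = \<alpha>"
    by (auto simp: End_Sym_def sym_hom_def sym_comp_def sym_id_def compose_def PiE_iff
        fun_eq_iff extensional_def)
qed

lemma group_Aut_Sym: "group (Aut_Sym X)"
  unfolding Aut_Sym_def by (rule monoid.units_group [OF monoid_End_Sym])

end

text \<open>In \<open>corollary2\<close> the simplices are drawn from the type \<open>'g + nat\<close>, where \<open>'g\<close> is the element type of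
  the given group: HOL cannot quantify existentially over types, and this type contains a copy of
  every set of cardinality at most \<open>max(|'g|, \<aleph>\<^sub>0)\<close>.\<close>

end

theory Submission imports Defs begin

text \<open>The group \<open>H\<close> is the automorphism group of its Cayley graph if the colours of the edges, which are
  again the elements of \<open>H\<close>, are kept fixed: a permutation \<open>g\<close> of \<open>H\<close> with \<open>g (a c) = g(a) c\<close> for all \<open>a\<close>
  and \<open>c\<close> is left multiplication by \<open>g(1)\<close>. To keep the colours fixed, make them vertices of a second
  sort and impose a well-order on them, since a well-order has no automorphism but the identity. What
  remains is to express two relations, \<open>c \<le> d\<close> on colours and \<open>b = a c\<close>, by a symmetric simplicial
  set. Its simplices have no intrinsic ordering of their vertices, so the roles in a relation are
  distinguished by multiplicity: \<open>c \<le> d\<close> is a triangle with vertices \<open>c, d, d\<close>, and \<open>b = a c\<close> is a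
  simplex of dimension \<open>2k + 1\<close> with vertices \<open>c\<close> (once), \<open>a\<close> (\<open>k\<close> times) and \<open>b\<close> (\<open>k + 1\<close> times). For
  \<open>k \<ge> 3\<close> the nondegenerate \<open>k\<close>-simplices all of whose vertices coincide also tell the group elements
  from the colours.

  A simplex with repeated vertices has to be distinguished from a degenerate simplex. A cell is a
  standard simplex with labelled vertices; an \<open>n\<close>-simplex \<open>q : [n] \<rightarrow> [N]\<close> of a cell with
  labels \<open>s\<close> is therefore remembered as the pair of the labels \<open>s \<circ> q\<close> and the kernel of \<open>q\<close>. An
  isomorphism preserves kernels, because membership in the kernel means being fixed by a map that
  collapses two vertices; so it is given by a bijection between the vertices
  (\<open>iso_by_vertex_map\<close>) and preserves the nondegenerate simplices (\<open>faces_iso\<close>). With this the group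
  of automorphisms is computed in \<open>automorphism_is_translation\<close>.

  The dimension of the cells distinguishes different values of \<open>k\<close>, which yields infinitely many
  isomorphism types. Finally, each level has at most \<open>max(|H|, \<aleph>\<^sub>0)\<close> simplices, so the construction
  can be copied to the type \<open>'g + nat\<close>.\<close>

unbundle cardinal_syntax

section \<open>Isomorphisms of symmetric simplicial sets\<close>

lemma sym_hom_closed:
  "\<alpha> \<in> sym_hom X Y \<Longrightarrow> x \<in> simplices X n \<Longrightarrow> \<alpha> n x \<in> simplices Y n"
  by (auto simp: sym_hom_def PiE_iff)

lemma sym_hom_natural:
  "\<alpha> \<in> sym_hom X Y \<Longrightarrow> f \<in> fin_map m n \<Longrightarrow> x \<in> simplices X n \<Longrightarrow>
    \<alpha> m (act X m n f x) = act Y m n f (\<alpha> n x)"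
  by (auto simp: sym_hom_def)

lemma sym_homI:
  assumes "\<And>n x. x \<in> simplices X n \<Longrightarrow> \<alpha> n x \<in> simplices Y n"
    and "\<And>n x. x \<notin> simplices X n \<Longrightarrow> \<alpha> n x = undefined"
    and "\<And>m n f x. f \<in> fin_map m n \<Longrightarrow> x \<in> simplices X n \<Longrightarrow>
      \<alpha> m (act X m n f x) = act Y m n f (\<alpha> n x)"
  shows "\<alpha> \<in> sym_hom X Y"
  using assms by (auto simp: sym_hom_def PiE_iff extensional_def)

lemma sym_hom_eqI:
  assumes "\<alpha> \<in> sym_hom X Y" "\<alpha>' \<in> sym_hom X Y"
    and "\<And>n x. x \<in> simplices X n \<Longrightarrow> \<alpha> n x = \<alpha>' n x"
  shows "\<alpha> = \<alpha>'"
proof (rule ext)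
  fix n
  have "\<alpha> n \<in> extensional (simplices X n)" "\<alpha>' n \<in> extensional (simplices X n)"
    using assms(1,2) by (auto simp: sym_hom_def PiE_iff)
  then show "\<alpha> n = \<alpha>' n"
    using assms(3) by (rule extensionalityI)
qed

lemma sym_comp_apply [simp]:
  "x \<in> simplices X n \<Longrightarrow> sym_comp X \<beta> \<alpha> n x = \<beta> n (\<alpha> n x)"
  by (simp add: sym_comp_def compose_def)

lemma sym_id_apply [simp]: "x \<in> simplices X n \<Longrightarrow> sym_id X n x = x"
  by (simp add: sym_id_def)

lemma sym_comp_closed:
  assumes "symmetric_simplicial_set X" "\<alpha> \<in> sym_hom X Y" "\<beta> \<in> sym_hom Y Z"
  shows "sym_comp X \<beta> \<alpha> \<in> sym_hom X Z"
proof (rule sym_homI)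
  fix m n f x
  assume f: "f \<in> fin_map m n" and x: "x \<in> simplices X n"
  have "act X m n f x \<in> simplices X m"
    using symmetric_simplicial_set.act_closed[OF assms(1) f x] .
  then show "sym_comp X \<beta> \<alpha> m (act X m n f x) = act Z m n f (sym_comp X \<beta> \<alpha> n x)"
    using f x assms by (simp add: sym_hom_natural sym_hom_closed)
qed (use assms in \<open>auto simp: sym_hom_closed sym_comp_def compose_def\<close>)

lemma sym_id_closed:
  assumes "symmetric_simplicial_set X"
  shows "sym_id X \<in> sym_hom X X"
  using symmetric_simplicial_set.act_closed[OF assms]
  by (intro sym_homI) (auto simp: sym_id_def)

lemma sym_comp_eq_id_iff:
  assumes "symmetric_simplicial_set X" "\<alpha> \<in> sym_hom X Y" "\<beta> \<in> sym_hom Y X"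
  shows "sym_comp X \<beta> \<alpha> = sym_id X \<longleftrightarrow> (\<forall>n. \<forall>x\<in>simplices X n. \<beta> n (\<alpha> n x) = x)"
proof
  assume "sym_comp X \<beta> \<alpha> = sym_id X"
  then show "\<forall>n. \<forall>x\<in>simplices X n. \<beta> n (\<alpha> n x) = x"
    by (metis sym_comp_apply sym_id_apply)
next
  assume "\<forall>n. \<forall>x\<in>simplices X n. \<beta> n (\<alpha> n x) = x"
  then show "sym_comp X \<beta> \<alpha> = sym_id X"
    by (intro sym_hom_eqI[OF sym_comp_closed[OF assms] sym_id_closed[OF assms(1)]]) auto
qed

text \<open>Mutually inverse isomorphisms, stated pointwise: calculations with simplices then replace
  calculations with extensional composites.\<close>

definition sym_inverses ::
    "'x sym_sset \<Rightarrow> 'y sym_sset \<Rightarrow> (nat \<Rightarrow> 'x \<Rightarrow> 'y) \<Rightarrow> (nat \<Rightarrow> 'y \<Rightarrow> 'x) \<Rightarrow> bool" where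
  "sym_inverses X Y \<alpha> \<beta> \<longleftrightarrow> \<alpha> \<in> sym_hom X Y \<and> \<beta> \<in> sym_hom Y X \<and>
     (\<forall>n. \<forall>x\<in>simplices X n. \<beta> n (\<alpha> n x) = x) \<and> (\<forall>n. \<forall>y\<in>simplices Y n. \<alpha> n (\<beta> n y) = y)"

lemma sym_inverses_swap: "sym_inverses X Y \<alpha> \<beta> \<Longrightarrow> sym_inverses Y X \<beta> \<alpha>"
  by (auto simp: sym_inverses_def)

lemma sym_inverses_comp:
  assumes "symmetric_simplicial_set X" "symmetric_simplicial_set Z"
    and "sym_inverses X Y \<alpha> \<beta>" "sym_inverses Y Z \<gamma> \<delta>"
  shows "sym_inverses X Z (sym_comp X \<gamma> \<alpha>) (sym_comp Z \<beta> \<delta>)"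
  using assms unfolding sym_inverses_def
  by (auto intro: sym_comp_closed simp: sym_hom_closed)

lemma sym_isomorphic_iff:
  assumes "symmetric_simplicial_set X" "symmetric_simplicial_set Y"
  shows "sym_isomorphic X Y \<longleftrightarrow> (\<exists>\<alpha> \<beta>. sym_inverses X Y \<alpha> \<beta>)"
  using sym_comp_eq_id_iff[OF assms(1)] sym_comp_eq_id_iff[OF assms(2)]
  unfolding sym_isomorphic_def sym_inverses_def by metis

lemma sym_isomorphic_refl:
  assumes "symmetric_simplicial_set X"
  shows "sym_isomorphic X X"
  unfolding sym_isomorphic_iff[OF assms assms]
  using sym_id_closed[OF assms] by (auto simp: sym_inverses_def intro!: exI[of _ "sym_id X"])

lemma sym_isomorphic_sym: "sym_isomorphic X Y \<Longrightarrow> sym_isomorphic Y X"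
  by (auto simp: sym_isomorphic_def)

lemma sym_isomorphic_trans:
  assumes "symmetric_simplicial_set X" "symmetric_simplicial_set Y" "symmetric_simplicial_set Z"
    and "sym_isomorphic X Y" "sym_isomorphic Y Z"
  shows "sym_isomorphic X Z"
  using assms sym_inverses_comp[OF assms(1,3)] by (metis sym_isomorphic_iff)

lemma carrier_Aut_Sym:
  assumes "symmetric_simplicial_set X"
  shows "\<alpha> \<in> carrier (Aut_Sym X) \<longleftrightarrow> (\<exists>\<beta>. sym_inverses X X \<alpha> \<beta>)"
  using sym_comp_eq_id_iff[OF assms, of _ X]
  unfolding Aut_Sym_def units_of_def Units_def End_Sym_def sym_inverses_def by auto

lemma mult_Aut_Sym [simp]: "\<beta> \<otimes>\<^bsub>Aut_Sym X\<^esub> \<alpha> = sym_comp X \<beta> \<alpha>"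
  by (simp add: Aut_Sym_def units_of_def End_Sym_def)

text \<open>Conjugation by an isomorphism; its inverse is conjugation by the inverse isomorphism.\<close>

lemma Aut_Sym_cong:
  assumes X: "symmetric_simplicial_set X" and Y: "symmetric_simplicial_set Y"
    and "sym_isomorphic X Y"
  shows "Aut_Sym X \<cong> Aut_Sym Y"
proof -
  obtain \<alpha> \<beta> where ab: "sym_inverses X Y \<alpha> \<beta>"
    using assms by (auto simp: sym_isomorphic_iff)
  \<comment> \<open>These two facts are stated for arbitrary \<open>P\<close> and \<open>Q\<close>, as both directions of
    the conjugation are needed.\<close>
  have closed: "\<exists>\<delta>. sym_inverses Q Q (sym_comp Q \<mu> (sym_comp Q \<phi> \<nu>)) \<delta>"
    if "symmetric_simplicial_set P" "symmetric_simplicial_set Q" "sym_inverses P Q \<mu> \<nu>"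
      "sym_inverses P P \<phi> \<psi>" for P :: "'c sym_sset" and Q :: "'d sym_sset" and \<mu> \<nu> \<phi> \<psi>
    using sym_inverses_comp[OF that(2,2) sym_inverses_comp[OF that(2,1)
        sym_inverses_swap[OF that(3)] that(4)] that(3)] by blast
  have inv: "sym_comp P \<nu> (sym_comp P (sym_comp Q \<mu> (sym_comp Q \<phi> \<nu>)) \<mu>) = \<phi>"
    if P: "symmetric_simplicial_set P" and Q: "symmetric_simplicial_set Q"
      and mn: "sym_inverses P Q \<mu> \<nu>" and phi: "sym_inverses P P \<phi> \<psi>"
    for P :: "'c sym_sset" and Q :: "'d sym_sset" and \<mu> \<nu> \<phi> \<psi>
  proof (rule sym_hom_eqI[of _ P P])
    note h = mn[unfolded sym_inverses_def] phi[unfolded sym_inverses_def]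
    show "sym_comp P \<nu> (sym_comp P (sym_comp Q \<mu> (sym_comp Q \<phi> \<nu>)) \<mu>) \<in> sym_hom P P"
      using h P Q by (meson sym_comp_closed)
    show "\<phi> \<in> sym_hom P P" using h by blast
    show "sym_comp P \<nu> (sym_comp P (sym_comp Q \<mu> (sym_comp Q \<phi> \<nu>)) \<mu>) n x = \<phi> n x"
      if "x \<in> simplices P n" for n x
      using that h by (auto simp: sym_hom_closed)
  qed
  let ?F = "\<lambda>\<phi>. sym_comp Y \<alpha> (sym_comp Y \<phi> \<beta>)"
  let ?G = "\<lambda>\<phi>. sym_comp X \<beta> (sym_comp X \<phi> \<alpha>)"
  have "?F \<in> iso (Aut_Sym X) (Aut_Sym Y)"
  proof (rule isoI)
    show "?F \<in> hom (Aut_Sym X) (Aut_Sym Y)"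
    proof (rule homI)
      show "?F \<phi> \<in> carrier (Aut_Sym Y)" if "\<phi> \<in> carrier (Aut_Sym X)" for \<phi>
        using that closed[OF X Y ab] by (auto simp: carrier_Aut_Sym X Y)
      fix \<phi> \<psi> assume "\<phi> \<in> carrier (Aut_Sym X)" "\<psi> \<in> carrier (Aut_Sym X)"
      then have h: "\<phi> \<in> sym_hom X X" "\<psi> \<in> sym_hom X X" "\<alpha> \<in> sym_hom X Y" "\<beta> \<in> sym_hom Y X"
        using ab by (auto simp: carrier_Aut_Sym X sym_inverses_def)
      have "?F (sym_comp X \<phi> \<psi>) = sym_comp Y (?F \<phi>) (?F \<psi>)"
      proof (rule sym_hom_eqI[of _ Y Y])
        show "?F (sym_comp X \<phi> \<psi>) \<in> sym_hom Y Y" "sym_comp Y (?F \<phi>) (?F \<psi>) \<in> sym_hom Y Y"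
          using h X Y by (meson sym_comp_closed)+
        show "?F (sym_comp X \<phi> \<psi>) n x = sym_comp Y (?F \<phi>) (?F \<psi>) n x"
          if "x \<in> simplices Y n" for n x
          using that h ab by (auto simp: sym_hom_closed sym_inverses_def)
      qed
      then show "?F (\<phi> \<otimes>\<^bsub>Aut_Sym X\<^esub> \<psi>) = ?F \<phi> \<otimes>\<^bsub>Aut_Sym Y\<^esub> ?F \<psi>" by simp
    qed
    show "bij_betw ?F (carrier (Aut_Sym X)) (carrier (Aut_Sym Y))"
    proof (rule bij_betwI[where g = ?G])
      show "?F \<in> carrier (Aut_Sym X) \<rightarrow> carrier (Aut_Sym Y)"
        using closed[OF X Y ab] by (auto simp: carrier_Aut_Sym X Y)
      show "?G \<in> carrier (Aut_Sym Y) \<rightarrow> carrier (Aut_Sym X)"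
        using closed[OF Y X sym_inverses_swap[OF ab]] by (auto simp: carrier_Aut_Sym X Y)
      show "?G (?F \<phi>) = \<phi>" if "\<phi> \<in> carrier (Aut_Sym X)" for \<phi>
        using that inv[OF X Y ab] by (auto simp: carrier_Aut_Sym X)
      show "?F (?G \<phi>) = \<phi>" if "\<phi> \<in> carrier (Aut_Sym Y)" for \<phi>
        using that inv[OF Y X sym_inverses_swap[OF ab]] by (auto simp: carrier_Aut_Sym Y)
    qed
  qed
  then show ?thesis by (auto simp: is_iso_def)
qed

text \<open>Each level is copied separately: its own injection suffices, even if the images of different
  levels overlap.\<close>

lemma transport_simplices:
  fixes X :: "'x sym_sset" and e :: "nat \<Rightarrow> 'x \<Rightarrow> 'y"
  assumes X: "symmetric_simplicial_set X" and e: "\<And>n. inj_on (e n) (simplices X n)"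
  shows "\<exists>Y :: 'y sym_sset. symmetric_simplicial_set Y \<and> sym_isomorphic X Y"
proof -
  define d where "d n = inv_into (simplices X n) (e n)" for n
  have d: "d n (e n x) = x" if "x \<in> simplices X n" for n x
    using that e by (simp add: d_def)
  define Y where "Y = \<lparr>simplices = \<lambda>n. e n ` simplices X n,
    act = \<lambda>m n f y. e m (act X m n f (d n y))\<rparr>"
  have e_eq: "e n x = e n x' \<longleftrightarrow> x = x'" if "x \<in> simplices X n" "x' \<in> simplices X n" for n x x'
    using inj_on_eq_iff[OF e] that by blast
  have sY: "simplices Y n = e n ` simplices X n" for n by (simp add: Y_def)
  have aY: "act Y m n f (e n x) = e m (act X m n f x)" if "x \<in> simplices X n" for m n f x
    using that d by (simp add: Y_def)
  have Y: "symmetric_simplicial_set Y"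
    by unfold_locales
      (auto simp: sY aY symmetric_simplicial_set.act_closed[OF X]
        symmetric_simplicial_set.act_id[OF X] symmetric_simplicial_set.act_comp[OF X])
  let ?\<alpha> = "\<lambda>n. \<lambda>x\<in>simplices X n. e n x"
  let ?\<beta> = "\<lambda>n. \<lambda>y\<in>simplices Y n. d n y"
  have "sym_inverses X Y ?\<alpha> ?\<beta>"
    unfolding sym_inverses_def
    by (intro conjI sym_homI)
      (auto simp: sY aY d e_eq symmetric_simplicial_set.act_closed[OF X])
  then show ?thesis
    using Y sym_isomorphic_iff[OF X Y] by blast
qed

section \<open>Symmetric simplicial sets generated by labelled simplices\<close>

text \<open>The map \<open>q : [n] \<rightarrow> [N]\<close> is an \<open>n\<close>-simplex of the standard \<open>N\<close>-simplex, whose vertices carry the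
  labels \<open>s\<close>. The kernel of \<open>q\<close> separates a repetition of a vertex caused by a degeneracy from one
  caused by two vertices of the cell that have the same label.\<close>

definition cell_face :: "nat \<Rightarrow> (nat \<Rightarrow> 'v) \<Rightarrow> (nat \<Rightarrow> nat) \<Rightarrow> (nat \<Rightarrow> 'v) \<times> (nat \<times> nat) set" where
  "cell_face n s q = (\<lambda>i\<in>{..n}. s (q i), {(i, j). i \<le> n \<and> j \<le> n \<and> q i = q j})"

text \<open>The image of the coproduct of the standard simplices in \<open>S\<close> under the map that sends \<open>q\<close> to its
  labels and its kernel. Simplices of different cells are thereby glued when labels and
  kernel agree. The pair \<open>(N, s)\<close> is a cell of dimension \<open>N\<close> with labels \<open>s 0, \<dots>, s N\<close>.\<close>

definition cell_sset ::
    "(nat \<times> (nat \<Rightarrow> 'v)) set \<Rightarrow> ((nat \<Rightarrow> 'v) \<times> (nat \<times> nat) set) sym_sset" where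
  "cell_sset S = \<lparr>simplices = \<lambda>n. \<Union>(N, s)\<in>S. cell_face n s ` fin_map n N,
     act = \<lambda>m n f x. (\<lambda>i\<in>{..m}. fst x (f i), {(i, j). i \<le> m \<and> j \<le> m \<and> (f i, f j) \<in> snd x})\<rparr>"

lemma fin_map_le: "f \<in> fin_map m n \<Longrightarrow> i \<le> m \<Longrightarrow> f i \<le> n"
  by (auto simp: PiE_iff)

lemma compose_fin_map: "f \<in> fin_map k m \<Longrightarrow> g \<in> fin_map m n \<Longrightarrow> compose {..k} g f \<in> fin_map k n"
  by (auto simp: PiE_iff compose_def)

lemma mem_cell_sset:
  "x \<in> simplices (cell_sset S) n \<longleftrightarrow> (\<exists>N s q. (N, s) \<in> S \<and> q \<in> fin_map n N \<and> x = cell_face n s q)"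
  by (auto simp: cell_sset_def)

lemma act_cell_sset:
  "act (cell_sset S) m n f x =
    (\<lambda>i\<in>{..m}. fst x (f i), {(i, j). i \<le> m \<and> j \<le> m \<and> (f i, f j) \<in> snd x})"
  by (simp add: cell_sset_def)

lemma act_cell_face:
  "f \<in> fin_map m n \<Longrightarrow>
    act (cell_sset S) m n f (cell_face n s q) = cell_face m s (compose {..m} q f)"
  using fin_map_le[of f m n]
  by (auto simp: act_cell_sset cell_face_def compose_def restrict_def)

lemma cell_face_cong: "(\<And>i. i \<le> n \<Longrightarrow> q i = q' i) \<Longrightarrow> cell_face n s q = cell_face n s q'"
  by (auto simp: cell_face_def fun_eq_iff)

lemma symmetric_simplicial_set_cell_sset: "symmetric_simplicial_set (cell_sset S)"
proof
  fix m n f x assume f: "f \<in> fin_map m n" and "x \<in> simplices (cell_sset S) n"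
  then obtain N s q where q: "(N, s) \<in> S" "q \<in> fin_map n N" "x = cell_face n s q"
    by (auto simp: mem_cell_sset)
  then show "act (cell_sset S) m n f x \<in> simplices (cell_sset S) m"
    using f compose_fin_map[OF f q(2)] by (auto simp: mem_cell_sset act_cell_face)
next
  fix n x assume "x \<in> simplices (cell_sset S) n"
  then show "act (cell_sset S) n n (\<lambda>i\<in>{..n}. i) x = x"
    by (auto simp: mem_cell_sset act_cell_face compose_def intro!: cell_face_cong)
next
  fix k m n f g x
  assume f: "f \<in> fin_map k m" and g: "g \<in> fin_map m n" and "x \<in> simplices (cell_sset S) n"
  then obtain s q where "x = cell_face n s q"
    by (auto simp: mem_cell_sset)
  then show "act (cell_sset S) k n (compose {..k} g f) x =
      act (cell_sset S) k m f (act (cell_sset S) m n g x)"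
    using fin_map_le[OF f]
    by (simp only: act_cell_face[OF f] act_cell_face[OF g] act_cell_face[OF compose_fin_map[OF f g]])
      (auto simp: compose_def intro!: cell_face_cong)
qed

text \<open>This describes the kernel of a simplex by the action alone, so that isomorphisms preserve it.\<close>

lemma collapse_fixes_iff:
  assumes "x \<in> simplices (cell_sset S) n" "i \<le> n" "j \<le> n"
  shows "act (cell_sset S) n n (\<lambda>l\<in>{..n}. if l = j then i else l) x = x \<longleftrightarrow> (i, j) \<in> snd x"
proof -
  let ?r = "\<lambda>l\<in>{..n}. if l = j then i else l"
  obtain N s q where x: "x = cell_face n s q"
    using assms(1) by (auto simp: mem_cell_sset)
  have r: "?r \<in> fin_map n n" using assms by auto
  show ?thesis
  proof
    assume "act (cell_sset S) n n ?r x = x"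
    then have "snd (act (cell_sset S) n n ?r x) = snd x" by simp
    moreover have "(i, j) \<in> snd (act (cell_sset S) n n ?r x)"
      using assms by (auto simp: act_cell_sset x cell_face_def)
    ultimately show "(i, j) \<in> snd x" by simp
  next
    assume "(i, j) \<in> snd x"
    then have "q i = q j" by (simp add: x cell_face_def)
    then show "act (cell_sset S) n n ?r x = x"
      unfolding x act_cell_face[OF r]
      by (intro cell_face_cong) (auto simp: compose_def)
  qed
qed

definition point :: "'v \<Rightarrow> (nat \<Rightarrow> 'v) \<times> (nat \<times> nat) set" where
  "point v = (\<lambda>i\<in>{..0}. v, {(0, 0)})"

definition vertex_map ::
  "(nat \<Rightarrow> (nat \<Rightarrow> 'v) \<times> (nat \<times> nat) set \<Rightarrow> (nat \<Rightarrow> 'w) \<times> (nat \<times> nat) set) \<Rightarrow> 'v \<Rightarrow> 'w" where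
  "vertex_map \<alpha> v = fst (\<alpha> 0 (point v)) 0"

text \<open>The labels are determined by naturality with respect to the constant maps from \<open>[0]\<close>, the kernel by
  \<open>collapse_fixes_iff\<close>, for which the inverse is needed: without it, simplices that are not fixed by a
  collapsing map might become fixed.\<close>

lemma iso_by_vertex_map:
  assumes inv: "sym_inverses (cell_sset S) (cell_sset T) \<alpha> \<beta>"
    and x: "x \<in> simplices (cell_sset S) n"
  shows "\<alpha> n x = (\<lambda>i\<in>{..n}. vertex_map \<alpha> (fst x i), snd x)"
proof -
  let ?X = "cell_sset S" and ?Y = "cell_sset T"
  have a: "\<alpha> \<in> sym_hom ?X ?Y" and b: "\<beta> \<in> sym_hom ?Y ?X" and ba: "\<beta> n (\<alpha> n x) = x"
    using inv x by (auto simp: sym_inverses_def)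
  have y: "\<alpha> n x \<in> simplices ?Y n" using a x by (rule sym_hom_closed)
  have sub: "snd z \<subseteq> {..n} \<times> {..n}" and refl: "i \<le> n \<Longrightarrow> (i, i) \<in> snd z"
    and ext: "fst z \<in> extensional {..n}"
    if "z \<in> simplices (cell_sset U) n" for U and z :: "(nat \<Rightarrow> 'c) \<times> (nat \<times> nat) set" and i
    using that by (auto simp: mem_cell_sset cell_face_def)
  have "fst (\<alpha> n x) i = vertex_map \<alpha> (fst x i)" if i: "i \<le> n" for i
  proof -
    let ?c = "\<lambda>l\<in>{..0::nat}. i"
    have c: "?c \<in> fin_map 0 n" using i by auto
    have "act ?X 0 n ?c x = point (fst x i)"
      using refl[OF x i] by (auto simp: act_cell_sset point_def)
    then have "\<alpha> 0 (point (fst x i)) = act ?Y 0 n ?c (\<alpha> n x)"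
      using sym_hom_natural[OF a c x] by simp
    then show ?thesis by (simp add: vertex_map_def act_cell_sset)
  qed
  then have 1: "fst (\<alpha> n x) = (\<lambda>i\<in>{..n}. vertex_map \<alpha> (fst x i))"
    by (intro extensionalityI[OF ext[OF y]]) auto
  have "(i, j) \<in> snd (\<alpha> n x) \<longleftrightarrow> (i, j) \<in> snd x" if ij: "i \<le> n" "j \<le> n" for i j
  proof -
    let ?r = "\<lambda>l\<in>{..n}. if l = j then i else l"
    have r: "?r \<in> fin_map n n" using ij by auto
    have "act ?Y n n ?r (\<alpha> n x) = \<alpha> n x \<longleftrightarrow> act ?X n n ?r x = x"
    proof
      assume "act ?Y n n ?r (\<alpha> n x) = \<alpha> n x"
      then have "\<beta> n (\<alpha> n x) = act ?X n n ?r (\<beta> n (\<alpha> n x))"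
        using sym_hom_natural[OF b r y] by argo
      then show "act ?X n n ?r x = x" unfolding ba by (rule sym)
    next
      assume "act ?X n n ?r x = x"
      then show "act ?Y n n ?r (\<alpha> n x) = \<alpha> n x"
        using sym_hom_natural[OF a r x] by argo
    qed
    then show ?thesis
      unfolding collapse_fixes_iff[OF x ij] collapse_fixes_iff[OF y ij] .
  qed
  then have "snd (\<alpha> n x) = snd x"
    using sub[OF x] sub[OF y] by auto
  with 1 show ?thesis by (simp add: prod_eq_iff)
qed

text \<open>The label sequences of the nondegenerate \<open>n\<close>-simplices: those with trivial kernel, that is, the ones
  that come from injective maps into a cell.\<close>

definition faces :: "(nat \<times> (nat \<Rightarrow> 'v)) set \<Rightarrow> nat \<Rightarrow> (nat \<Rightarrow> 'v) set" where
  "faces S n = {u. \<exists>N s q. (N, s) \<in> S \<and> inj_on q {..n} \<and> (\<forall>i\<le>n. q i \<le> N \<and> u i = s (q i))}"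

lemma mem_faces_iff:
  "u \<in> faces S n \<longleftrightarrow> (restrict u {..n}, Id_on {..n}) \<in> simplices (cell_sset S) n"
proof
  assume "u \<in> faces S n"
  then obtain N s q where q: "(N, s) \<in> S" "inj_on q {..n}" "\<forall>i\<le>n. q i \<le> N \<and> u i = s (q i)"
    by (auto simp: faces_def)
  then have "(restrict u {..n}, Id_on {..n}) = cell_face n s (restrict q {..n})"
    by (auto simp: cell_face_def inj_on_def Id_on_iff)
  moreover have "restrict q {..n} \<in> fin_map n N" using q by auto
  ultimately show "(restrict u {..n}, Id_on {..n}) \<in> simplices (cell_sset S) n"
    using q(1) unfolding mem_cell_sset by blast
next
  assume "(restrict u {..n}, Id_on {..n}) \<in> simplices (cell_sset S) n"
  then obtain N s q where S: "(N, s) \<in> S" and q: "q \<in> fin_map n N"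
    and eq: "restrict u {..n} = (\<lambda>i\<in>{..n}. s (q i))"
      "Id_on {..n} = {(i, j). i \<le> n \<and> j \<le> n \<and> q i = q j}"
    by (auto simp: mem_cell_sset cell_face_def)
  have "inj_on q {..n}"
  proof (rule inj_onI)
    fix i j assume "i \<in> {..n}" "j \<in> {..n}" "q i = q j"
    then have "(i, j) \<in> Id_on {..n}" unfolding eq(2) by simp
    then show "i = j" by auto
  qed
  moreover have "u i = s (q i)" if "i \<le> n" for i
    using fun_cong[OF eq(1), of i] that by simp
  ultimately show "u \<in> faces S n"
    using S fin_map_le[OF q] unfolding faces_def by blast
qed

lemma point_mem_iff: "point v \<in> simplices (cell_sset S) 0 \<longleftrightarrow> (\<lambda>_. v) \<in> faces S 0"
proof -
  have "(restrict (\<lambda>_. v) {..0}, Id_on {..0}) = point v"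
    by (auto simp: point_def)
  then show ?thesis unfolding mem_faces_iff by metis
qed

lemma faces_iso:
  assumes "sym_inverses (cell_sset S) (cell_sset T) \<alpha> \<beta>" "u \<in> faces S n"
  shows "(\<lambda>i. vertex_map \<alpha> (u i)) \<in> faces T n"
proof -
  let ?x = "(restrict u {..n}, Id_on {..n})"
  have x: "?x \<in> simplices (cell_sset S) n" using assms(2) by (simp add: mem_faces_iff)
  have "\<alpha> n ?x \<in> simplices (cell_sset T) n"
    using assms(1) x by (auto simp: sym_inverses_def intro: sym_hom_closed)
  moreover have "\<alpha> n ?x = (restrict (\<lambda>i. vertex_map \<alpha> (u i)) {..n}, Id_on {..n})"
    unfolding iso_by_vertex_map[OF assms(1) x] by (auto simp: fun_eq_iff)
  ultimately show ?thesis by (simp add: mem_faces_iff)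
qed

lemma vertex_map_inverse:
  assumes inv: "sym_inverses (cell_sset S) (cell_sset T) \<alpha> \<beta>" and v: "(\<lambda>_. v) \<in> faces S 0"
  shows "vertex_map \<beta> (vertex_map \<alpha> v) = v"
proof -
  have x: "point v \<in> simplices (cell_sset S) 0"
    using v by (simp add: point_mem_iff)
  have "\<alpha> 0 (point v) = point (vertex_map \<alpha> v)"
    unfolding iso_by_vertex_map[OF inv x] by (auto simp: point_def)
  then have "vertex_map \<beta> (vertex_map \<alpha> v) = fst (\<beta> 0 (\<alpha> 0 (point v))) 0"
    by (simp add: vertex_map_def)
  also have "\<dots> = v"
    using inv x by (simp add: sym_inverses_def) (simp add: point_def)
  finally show ?thesis .
qed

definition relabel ::
  "(nat \<times> (nat \<Rightarrow> 'v)) set \<Rightarrow> ('v \<Rightarrow> 'w) \<Rightarrow>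
    nat \<Rightarrow> (nat \<Rightarrow> 'v) \<times> (nat \<times> nat) set \<Rightarrow> (nat \<Rightarrow> 'w) \<times> (nat \<times> nat) set" where
  "relabel S \<sigma> n = (\<lambda>x\<in>simplices (cell_sset S) n. (\<lambda>i\<in>{..n}. \<sigma> (fst x i), snd x))"

lemma relabel_in_sym_hom:
  assumes "\<And>N s. (N, s) \<in> S \<Longrightarrow> \<exists>t. (N, t) \<in> T \<and> (\<forall>i\<le>N. t i = \<sigma> (s i))"
  shows "relabel S \<sigma> \<in> sym_hom (cell_sset S) (cell_sset T)"
proof (rule sym_homI)
  fix n x assume x: "x \<in> simplices (cell_sset S) n"
  then obtain N s q where q: "(N, s) \<in> S" "q \<in> fin_map n N" "x = cell_face n s q"
    by (auto simp: mem_cell_sset)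
  then obtain t where t: "(N, t) \<in> T" "\<forall>i\<le>N. t i = \<sigma> (s i)"
    using assms by blast
  then have "relabel S \<sigma> n x = cell_face n t q"
    using x q(3) fin_map_le[OF q(2)] by (auto simp: relabel_def cell_face_def fun_eq_iff)
  then show "relabel S \<sigma> n x \<in> simplices (cell_sset T) n"
    using t(1) q(2) unfolding mem_cell_sset by blast
next
  fix m n f x assume f: "f \<in> fin_map m n" and x: "x \<in> simplices (cell_sset S) n"
  have "act (cell_sset S) m n f x \<in> simplices (cell_sset S) m"
    using symmetric_simplicial_set.act_closed[OF symmetric_simplicial_set_cell_sset f x] .
  then show "relabel S \<sigma> m (act (cell_sset S) m n f x) = act (cell_sset T) m n f (relabel S \<sigma> n x)"
    using x fin_map_le[OF f] by (auto simp: relabel_def act_cell_sset fun_eq_iff)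
qed (simp add: relabel_def)

text \<open>Each cell has only finitely many simplices on each level.\<close>

lemma cell_sset_small:
  assumes "infinite (UNIV :: 'y set)" and "|S| \<le>o |UNIV :: 'y set|"
  shows "|simplices (cell_sset S) n| \<le>o |UNIV :: 'y set|"
proof -
  have "|(case p of (N, s) \<Rightarrow> cell_face n s ` fin_map n N)| \<le>o |UNIV :: 'y set|" for p
    using assms(1) by (intro ordLess_imp_ordLeq finite_ordLess_infinite)
      (auto simp: Field_card_of card_of_well_order_on split: prod.split intro!: finite_imageI finite_PiE)
  then show ?thesis
    unfolding cell_sset_def using assms
    by (auto intro!: card_of_UNION_ordLeq_infinite)
qed

section \<open>The cells of a well-ordered group\<close>

text \<open>In \<open>'g + 'g\<close> the left summand holds the group elements and the right one the colours. The cell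
  stands for the relation \<open>c \<le> d\<close>.\<close>

definition order_cell :: "'g \<Rightarrow> 'g \<Rightarrow> nat \<Rightarrow> 'g + 'g" where
  "order_cell c d i = (if i = 0 then Inr c else Inr d)"

text \<open>This cell stands for the relation \<open>b = a c\<close>. The multiplicities \<open>k\<close> and \<open>k + 1\<close> make \<open>a\<close> and
  \<open>b\<close> recognisable.\<close>

definition mult_cell :: "nat \<Rightarrow> 'g \<Rightarrow> 'g \<Rightarrow> 'g \<Rightarrow> nat \<Rightarrow> 'g + 'g" where
  "mult_cell k c a b i = (if i = 0 then Inr c else if i \<le> k then Inl a else Inl b)"

text \<open>The order \<open>r\<close> serves to make the set of colours rigid.\<close>

locale well_ordered_group = group H for H (structure) +
  fixes r :: "('a \<times> 'a) set"
  assumes well_order: "well_order_on (carrier H) r"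
begin

definition cells :: "nat \<Rightarrow> (nat \<times> (nat \<Rightarrow> 'a + 'a)) set" where
  "cells k = (\<lambda>(c, d). (2, order_cell c d)) ` r \<union>
     (\<lambda>(a, c). (2 * k + 1, mult_cell k c a (a \<otimes> c))) ` (carrier H \<times> carrier H)"

definition translate :: "'a \<Rightarrow> 'a + 'a \<Rightarrow> 'a + 'a" where
  "translate h = map_sum (\<lambda>a. h \<otimes> a) id"

lemma cells_cases:
  assumes "(N, s) \<in> cells k"
  obtains (order) c d where "(c, d) \<in> r" "N = 2" "s = order_cell c d"
  | (mult) a c where "a \<in> carrier H" "c \<in> carrier H" "N = 2 * k + 1" "s = mult_cell k c a (a \<otimes> c)"
  using assms by (auto simp: cells_def)

lemma order_cell_in_cells: "(c, d) \<in> r \<Longrightarrow> (2, order_cell c d) \<in> cells k"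
  by (auto simp: cells_def)

lemma mult_cell_in_cells:
  "a \<in> carrier H \<Longrightarrow> c \<in> carrier H \<Longrightarrow> (2 * k + 1, mult_cell k c a (a \<otimes> c)) \<in> cells k"
  by (auto simp: cells_def)

lemma r_in_carrier: "(c, d) \<in> r \<Longrightarrow> c \<in> carrier H \<and> d \<in> carrier H"
  using well_order by (auto simp: well_order_on_def linear_order_on_def partial_order_on_def
      preorder_on_def)

lemma cell_in_faces: "(N, s) \<in> cells k \<Longrightarrow> s \<in> faces (cells k) N"
  unfolding faces_def by (auto intro!: exI[of _ N] exI[of _ s] exI[of _ id])

lemma vertices_cells:
  assumes "k \<ge> 1"
  shows "(\<lambda>_. v) \<in> faces (cells k) 0 \<longleftrightarrow> v \<in> Inl ` carrier H \<union> Inr ` carrier H"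
proof
  assume "(\<lambda>_. v) \<in> faces (cells k) 0"
  then obtain N s q where "(N, s) \<in> cells k" "v = s (q 0)"
    by (auto simp: faces_def)
  then show "v \<in> Inl ` carrier H \<union> Inr ` carrier H"
    by (cases rule: cells_cases) (auto simp: order_cell_def mult_cell_def r_in_carrier)
next
  have face: "(\<lambda>_. s i) \<in> faces (cells k) 0" if "(N, s) \<in> cells k" "i \<le> N" for N s i
    using that unfolding faces_def by (auto intro!: exI[of _ N] exI[of _ s] exI[of _ "\<lambda>_. i"])
  assume "v \<in> Inl ` carrier H \<union> Inr ` carrier H"
  then consider a where "a \<in> carrier H" "v = Inl a" | c where "c \<in> carrier H" "v = Inr c"
    by blast
  then show "(\<lambda>_. v) \<in> faces (cells k) 0"
  proof cases
    case (1 a)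
    then show ?thesis
      using face[OF mult_cell_in_cells[of a \<one> k], of 1] assms by (simp add: mult_cell_def)
  next
    case (2 c)
    then show ?thesis
      using face[OF mult_cell_in_cells[of \<one> c k], of 0] by (simp add: mult_cell_def)
  qed
qed

text \<open>A colour occurs at most three times in a cell, in the cell of \<open>c \<le> c\<close>, whereas every group element
  occurs at least \<open>k + 1\<close> times in some cell. Thus the two sorts of vertices can be told apart.\<close>

lemma constant_faces_cells:
  assumes "k \<ge> 3"
  shows "(\<lambda>_. v) \<in> faces (cells k) k \<longleftrightarrow> v \<in> Inl ` carrier H"
proof
  assume "(\<lambda>_. v) \<in> faces (cells k) k"
  then obtain N s q where cell: "(N, s) \<in> cells k" and q: "inj_on q {..k}" "\<forall>i\<le>k. q i \<le> N"
    and v: "\<forall>i\<le>k. v = s (q i)"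
    by (auto simp: faces_def)
  from cell show "v \<in> Inl ` carrier H"
  proof (cases rule: cells_cases)
    case order
    have "card {..k} \<le> card {..N}" using q by (intro card_inj_on_le) auto
    then show ?thesis using assms order by simp
  next
    case (mult a c)
    have "q 0 \<noteq> q 1" using q(1) assms by (auto dest: inj_onD)
    then have "q 0 \<noteq> 0 \<or> q 1 \<noteq> 0" by linarith
    moreover have "0 \<le> k" "1 \<le> k" using assms by linarith+
    ultimately obtain i where "i \<le> k" "q i \<noteq> 0" by blast
    then show ?thesis using v mult by (auto simp: mult_cell_def)
  qed
next
  assume "v \<in> Inl ` carrier H"
  then obtain a where "a \<in> carrier H" "v = Inl a" by blast
  then show "(\<lambda>_. v) \<in> faces (cells k) k"
    using mult_cell_in_cells[of a \<one> k] assms unfolding faces_def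
    by (auto intro!: exI[of _ "2 * k + 1"] exI[of _ "mult_cell k \<one> a (a \<otimes> \<one>)"] exI[of _ Suc]
        simp: mult_cell_def)
qed

text \<open>A triangle with three vertices among the colours can only lie in an order cell, as a multiplication
  cell has a single colour. Unless all its vertices coincide, the one that occurs twice is the larger one.\<close>

lemma order_cell_faces:
  "order_cell c d \<in> faces (cells k) 2 \<longleftrightarrow> (c, d) \<in> r"
proof
  assume "order_cell c d \<in> faces (cells k) 2"
  then obtain N s q where cell: "(N, s) \<in> cells k" and q: "inj_on q {..2}" "\<forall>i\<le>2. q i \<le> N"
    and s: "\<forall>i\<le>2. order_cell c d i = s (q i)"
    by (auto simp: faces_def)
  have qs: "q 0 \<noteq> q 1" "q 0 \<noteq> q 2" "q 1 \<noteq> q 2"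
    using q(1) by (auto dest: inj_onD)
  have v: "s (q 0) = Inr c" "s (q 1) = Inr d" "s (q 2) = Inr d"
    using s by (auto simp: order_cell_def dest: spec[of _ 0] spec[of _ 1] spec[of _ 2])
  from cell show "(c, d) \<in> r"
  proof (cases rule: cells_cases)
    case (order c' d')
    have "q 0 \<le> 2" "q 1 \<le> 2" "q 2 \<le> 2" using q(2) order by auto
    then show ?thesis
      using v qs order by (auto simp: order_cell_def split: if_splits)
  next
    case mult
    then show ?thesis using v qs by (auto simp: mult_cell_def split: if_splits)
  qed
qed (use cell_in_faces order_cell_in_cells in blast)

lemma card_mult_cell_fibre:
  "card {i. i \<le> 2 * k + 1 \<and> mult_cell k c a b i = Inl v} =
    (if v = a then k else 0) + (if v = b then k + 1 else 0)"
proof -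
  have "{i. i \<le> 2 * k + 1 \<and> mult_cell k c a b i = Inl v} =
      (if v = a then {1..k} else {}) \<union> (if v = b then {k<..2 * k + 1} else {})"
    by (auto simp: mult_cell_def)
  also have "card \<dots> = (if v = a then k else 0) + (if v = b then k + 1 else 0)"
    by (subst card_Un_disjoint) auto
  finally show ?thesis .
qed

text \<open>For \<open>k \<ge> 1\<close> only multiplication cells have dimension \<open>2k + 1\<close>. So the two label sequences agree up to
  a permutation, and counting how often a label occurs recovers the three arguments. This also covers
  \<open>a = b\<close>, where the label occurs \<open>2k + 1\<close> times.\<close>

lemma mult_cell_faces:
  assumes "k \<ge> 1" and "mult_cell k c a b \<in> faces (cells k) (2 * k + 1)"
  shows "b = a \<otimes> c"
proof -
  let ?n = "2 * k + 1"
  obtain N s q where cell: "(N, s) \<in> cells k" and q: "inj_on q {..?n}" "\<forall>i\<le>?n. q i \<le> N"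
    and s: "\<forall>i\<le>?n. mult_cell k c a b i = s (q i)"
    using assms(2) by (auto simp: faces_def)
  have card: "card {..?n} \<le> card {..N}"
    using q by (intro card_inj_on_le) auto
  from cell show ?thesis
  proof (cases rule: cells_cases)
    case order
    then show ?thesis using card assms(1) by simp
  next
    case (mult a' c')
    have q_perm: "bij_betw q {..?n} {..?n}"
      using q mult endo_inj_surj[of "{..?n}" q] by (auto simp: bij_betw_def image_subset_iff)
    then have surj: "q ` {..?n} = {..?n}" by (rule bij_betw_imp_surj_on)
    have fibre: "card {i. i \<le> ?n \<and> mult_cell k c a b i = w} = card {i. i \<le> ?n \<and> s i = w}" for w
    proof -
      have "{i. i \<le> ?n \<and> s i = w} = {j \<in> q ` {..?n}. s j = w}"
        unfolding surj by auto
      also have "\<dots> = q ` {i. i \<le> ?n \<and> mult_cell k c a b i = w}"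
        using s by auto
      also have "card \<dots> = card {i. i \<le> ?n \<and> mult_cell k c a b i = w}"
        using q(1) by (intro card_image) (auto elim: inj_on_subset)
      finally show ?thesis by simp
    qed
    have "0 \<in> q ` {..?n}" unfolding surj by simp
    then obtain i where "i \<le> ?n" "q i = 0" by auto
    then have "mult_cell k c a b i = Inr c'"
      using s mult by (simp add: mult_cell_def)
    then have "c = c'" by (auto simp: mult_cell_def split: if_splits)
    moreover have count: "(if v = a then k else 0) + (if v = b then k + 1 else 0) =
        (if v = a' then k else 0) + (if v = a' \<otimes> c' then k + 1 else 0)" for v
      using fibre[of "Inl v"] unfolding mult card_mult_cell_fibre .
    have "b = a' \<otimes> c'" "a = a'"
      using count[of a] count[of b] assms(1) by (auto split: if_splits)
    ultimately show ?thesis by simp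
  qed
qed

section \<open>Automorphisms are left multiplications\<close>

lemma translate_cells:
  assumes "h \<in> carrier H" "(N, s) \<in> cells k"
  shows "\<exists>t. (N, t) \<in> cells k \<and> (\<forall>i\<le>N. t i = translate h (s i))"
  using assms(2)
proof (cases rule: cells_cases)
  case (order c d)
  then show ?thesis
    using assms(2) by (intro exI[of _ s]) (auto simp: order_cell_def translate_def)
next
  case (mult a c)
  then show ?thesis
    using assms(1) mult_cell_in_cells[of "h \<otimes> a" c k]
    by (intro exI[of _ "mult_cell k c (h \<otimes> a) (h \<otimes> a \<otimes> c)"])
      (auto simp: mult_cell_def translate_def m_assoc)
qed

definition translation :: "nat \<Rightarrow> 'a \<Rightarrow> nat \<Rightarrow> (nat \<Rightarrow> 'a + 'a) \<times> (nat \<times> nat) set \<Rightarrow>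
    (nat \<Rightarrow> 'a + 'a) \<times> (nat \<times> nat) set" where
  "translation k h = relabel (cells k) (translate h)"

lemma translation_closed: "h \<in> carrier H \<Longrightarrow> translation k h \<in> sym_hom (cell_sset (cells k)) (cell_sset (cells k))"
  unfolding translation_def by (intro relabel_in_sym_hom translate_cells)

lemma labels_cells:
  assumes "x \<in> simplices (cell_sset (cells k)) n" "i \<le> n"
  shows "fst x i \<in> Inl ` carrier H \<union> Inr ` carrier H"
proof -
  obtain N s q where "(N, s) \<in> cells k" "x = cell_face n s q"
    using assms(1) by (auto simp: mem_cell_sset)
  then show ?thesis using assms(2)
    by (cases rule: cells_cases) (auto simp: cell_face_def order_cell_def mult_cell_def r_in_carrier)
qed

lemma translation_mult:
  assumes "g \<in> carrier H" "h \<in> carrier H" "x \<in> simplices (cell_sset (cells k)) n"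
  shows "translation k g n (translation k h n x) = translation k (g \<otimes> h) n x"
proof -
  have "translation k h n x \<in> simplices (cell_sset (cells k)) n"
    using translation_closed assms by (auto intro: sym_hom_closed)
  then have "translation k g n (translation k h n x) =
      (\<lambda>i\<in>{..n}. translate g (translate h (fst x i)), snd x)"
    using assms(3) by (simp add: translation_def relabel_def fun_eq_iff)
  also have "\<dots> = (\<lambda>i\<in>{..n}. translate (g \<otimes> h) (fst x i), snd x)"
    using labels_cells[OF assms(3)] assms(1,2)
    by (fastforce simp: fun_eq_iff translate_def m_assoc)
  finally show ?thesis using assms(3) by (simp add: translation_def relabel_def)
qed

lemma translation_one:
  assumes "x \<in> simplices (cell_sset (cells k)) n"
  shows "translation k \<one> n x = x"
proof -
  have ext: "fst x \<in> extensional {..n}"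
    using assms by (auto simp: mem_cell_sset cell_face_def)
  have "(\<lambda>i\<in>{..n}. translate \<one> (fst x i)) = fst x"
  proof (rule extensionalityI[OF _ ext])
    fix i assume "i \<in> {..n}"
    then show "(\<lambda>i\<in>{..n}. translate \<one> (fst x i)) i = fst x i"
      using labels_cells[OF assms, of i] by (auto simp: translate_def)
  qed simp
  then show ?thesis using assms by (simp add: translation_def relabel_def)
qed

lemma translation_inverses:
  assumes "h \<in> carrier H"
  shows "sym_inverses (cell_sset (cells k)) (cell_sset (cells k)) (translation k h) (translation k (inv h))"
  using assms by (auto simp: sym_inverses_def translation_closed translation_mult translation_one)

text \<open>Embeddings of a well-order are unique, so an automorphism is the identity.\<close>

lemma well_order_rigid:
  assumes "bij_betw f (carrier H) (carrier H)"
    and "\<And>c d. c \<in> carrier H \<Longrightarrow> d \<in> carrier H \<Longrightarrow> (c, d) \<in> r \<longleftrightarrow> (f c, f d) \<in> r"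
    and "c \<in> carrier H"
  shows "f c = c"
proof -
  have field: "Field r = carrier H" and wo: "Well_order r"
    using well_order well_order_on_Well_order by blast+
  have "BNF_Wellorder_Embedding.iso r r f"
    unfolding iso_iff2 field using assms(1,2) by auto
  then have "embed r r f" by (simp add: BNF_Wellorder_Embedding.iso_def)
  moreover have "embed r r id" by (rule id_embed)
  ultimately show ?thesis
    using embed_unique[OF wo wo, of f id] assms(3) field by auto
qed

text \<open>The vertex map \<open>\<sigma>\<close> preserves the two sorts, hence consists of a permutation \<open>f\<close> of the colours and a
  permutation \<open>g\<close> of the group. The order cells force \<open>f\<close> to be the identity; then the multiplication
  cells give \<open>g (a c) = g(a) c\<close>, which makes \<open>g\<close> the left multiplication by \<open>g(1)\<close>.\<close>

lemma automorphism_is_translation: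
  assumes k: "k \<ge> 3"
    and inv: "sym_inverses (cell_sset (cells k)) (cell_sset (cells k)) \<alpha> \<beta>"
  shows "\<exists>h\<in>carrier H. \<alpha> = translation k h"
proof -
  let ?V = "Inl ` carrier H \<union> Inr ` carrier H"
  define \<sigma> where "\<sigma> = vertex_map \<alpha>"
  define \<tau> where "\<tau> = vertex_map \<beta>"
  note inv' = sym_inverses_swap[OF inv]
  have k1: "k \<ge> 1" using k by simp
  have \<sigma>_faces: "(\<lambda>i. \<sigma> (u i)) \<in> faces (cells k) n" if "u \<in> faces (cells k) n" for u n
    using faces_iso[OF inv that] by (simp add: \<sigma>_def)
  have \<tau>_faces: "(\<lambda>i. \<tau> (u i)) \<in> faces (cells k) n" if "u \<in> faces (cells k) n" for u n
    using faces_iso[OF inv' that] by (simp add: \<tau>_def)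
  have \<tau>\<sigma>: "\<tau> (\<sigma> v) = v" and \<sigma>\<tau>: "\<sigma> (\<tau> v) = v" if "v \<in> ?V" for v
    using that vertex_map_inverse[OF inv] vertex_map_inverse[OF inv']
    by (simp_all only: \<sigma>_def \<tau>_def vertices_cells[OF k1])
  have \<sigma>V: "\<sigma> v \<in> ?V" and \<tau>V: "\<tau> v \<in> ?V" if "v \<in> ?V" for v
    using that \<sigma>_faces[of "\<lambda>_. v" 0] \<tau>_faces[of "\<lambda>_. v" 0]
    by (simp_all only: vertices_cells[OF k1])
  have \<sigma>Inl: "\<sigma> v \<in> Inl ` carrier H" and \<tau>Inl: "\<tau> v \<in> Inl ` carrier H"
    if "v \<in> Inl ` carrier H" for v
    using that \<sigma>_faces[of "\<lambda>_. v" k] \<tau>_faces[of "\<lambda>_. v" k]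
    by (simp_all only: constant_faces_cells[OF k])
  \<comment> \<open>Colours stay colours because the inverse \<open>\<tau>\<close> maps group elements to group elements.\<close>
  have \<sigma>Inr: "\<sigma> v \<in> Inr ` carrier H" if "v \<in> Inr ` carrier H" for v
    using \<sigma>V[of v] \<tau>Inl[of "\<sigma> v"] \<tau>\<sigma>[of v] that by auto
  have \<tau>Inr: "\<tau> v \<in> Inr ` carrier H" if "v \<in> Inr ` carrier H" for v
    using \<tau>V[of v] \<sigma>Inl[of "\<tau> v"] \<sigma>\<tau>[of v] that by auto
  define f where "f c = projr (\<sigma> (Inr c))" for c
  define f' where "f' c = projr (\<tau> (Inr c))" for c
  define g where "g a = projl (\<sigma> (Inl a))" for a
  have f: "\<sigma> (Inr c) = Inr (f c)" "f c \<in> carrier H" if "c \<in> carrier H" for c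
    using \<sigma>Inr[of "Inr c"] that by (auto simp: f_def)
  have f': "\<tau> (Inr c) = Inr (f' c)" "f' c \<in> carrier H" if "c \<in> carrier H" for c
    using \<tau>Inr[of "Inr c"] that by (auto simp: f'_def)
  have g: "\<sigma> (Inl a) = Inl (g a)" "g a \<in> carrier H" if "a \<in> carrier H" for a
    using \<sigma>Inl[of "Inl a"] that by (auto simp: g_def)
  have f'f: "f' (f c) = c" and ff': "f (f' c) = c" if "c \<in> carrier H" for c
    using \<tau>\<sigma>[of "Inr c"] \<sigma>\<tau>[of "Inr c"] f f' that by auto
  have f_mono: "(f c, f d) \<in> r" if "(c, d) \<in> r" for c d
  proof -
    have "(\<lambda>i. \<sigma> (order_cell c d i)) = order_cell (f c) (f d)"
      using r_in_carrier[OF that] f by (auto simp: order_cell_def)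
    then show ?thesis using \<sigma>_faces[of "order_cell c d" 2] that by (simp add: order_cell_faces)
  qed
  have f'_mono: "(f' c, f' d) \<in> r" if "(c, d) \<in> r" for c d
  proof -
    have "(\<lambda>i. \<tau> (order_cell c d i)) = order_cell (f' c) (f' d)"
      using r_in_carrier[OF that] f' by (auto simp: order_cell_def)
    then show ?thesis using \<tau>_faces[of "order_cell c d" 2] that by (simp add: order_cell_faces)
  qed
  have f_id: "f c = c" if "c \<in> carrier H" for c
  proof (rule well_order_rigid[OF _ _ that])
    show "bij_betw f (carrier H) (carrier H)"
      by (rule bij_betwI[where g = f']) (auto simp: f f' f'f ff')
    show "(c, d) \<in> r \<longleftrightarrow> (f c, f d) \<in> r" if "c \<in> carrier H" "d \<in> carrier H" for c d
      using f_mono[of c d] f'_mono[of "f c" "f d"] f'f that by auto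
  qed
  have g_mult: "g (a \<otimes> c) = g a \<otimes> c" if "a \<in> carrier H" "c \<in> carrier H" for a c
  proof (rule mult_cell_faces[OF k1])
    have "(\<lambda>i. \<sigma> (mult_cell k c a (a \<otimes> c) i)) = mult_cell k c (g a) (g (a \<otimes> c))"
      using that by (auto simp: mult_cell_def f f_id g)
    then show "mult_cell k c (g a) (g (a \<otimes> c)) \<in> faces (cells k) (2 * k + 1)"
      using \<sigma>_faces[OF cell_in_faces[OF mult_cell_in_cells[OF that]]] by simp
  qed
  have g_one: "g c = g \<one> \<otimes> c" if "c \<in> carrier H" for c
    using g_mult[of \<one> c] that by simp
  have \<sigma>_eq: "\<sigma> v = translate (g \<one>) v" if "v \<in> ?V" for v
    using that by (auto simp: translate_def f f_id g g_one[symmetric])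
  have "\<alpha> = translation k (g \<one>)"
  proof (rule sym_hom_eqI)
    show "\<alpha> \<in> sym_hom (cell_sset (cells k)) (cell_sset (cells k))"
      using inv by (simp add: sym_inverses_def)
    show "translation k (g \<one>) \<in> sym_hom (cell_sset (cells k)) (cell_sset (cells k))"
      using g by (simp add: translation_closed)
    fix n x assume x: "x \<in> simplices (cell_sset (cells k)) n"
    show "\<alpha> n x = translation k (g \<one>) n x"
      unfolding iso_by_vertex_map[OF inv x] \<sigma>_def[symmetric]
      using x labels_cells[OF x] by (auto simp: translation_def relabel_def fun_eq_iff \<sigma>_eq)
  qed
  then show ?thesis using g by blast
qed

text \<open>Left multiplications by different elements move the vertex \<open>1\<close> to different places.\<close>

lemma translation_inj:
  assumes "g \<in> carrier H" "h \<in> carrier H" "translation k g = translation k h" "k \<ge> 1"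
  shows "g = h"
proof -
  have "(\<lambda>_. Inl \<one>) \<in> faces (cells k) 0"
    using vertices_cells[OF assms(4), of "Inl \<one>"] by blast
  then have x: "point (Inl \<one>) \<in> simplices (cell_sset (cells k)) 0"
    by (simp add: point_mem_iff)
  have "fst (translation k g' 0 (point (Inl \<one>))) 0 = Inl g'" if "g' \<in> carrier H" for g'
    using x that by (simp add: translation_def relabel_def) (simp add: point_def translate_def)
  then show ?thesis using assms by (metis sum.inject(1))
qed

lemma Aut_cells:
  assumes "k \<ge> 3"
  shows "Aut_Sym (cell_sset (cells k)) \<cong> H"
proof -
  let ?A = "Aut_Sym (cell_sset (cells k))"
  have carrier: "\<alpha> \<in> carrier ?A \<longleftrightarrow>
      (\<exists>\<beta>. sym_inverses (cell_sset (cells k)) (cell_sset (cells k)) \<alpha> \<beta>)" for \<alpha>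
    by (rule carrier_Aut_Sym[OF symmetric_simplicial_set_cell_sset])
  have "translation k \<in> iso H ?A"
  proof (rule isoI)
    show "translation k \<in> hom H ?A"
    proof (rule homI)
      show "translation k h \<in> carrier ?A" if "h \<in> carrier H" for h
        using translation_inverses[OF that] by (auto simp: carrier)
      fix g h assume gh: "g \<in> carrier H" "h \<in> carrier H"
      show "translation k (g \<otimes> h) = translation k g \<otimes>\<^bsub>?A\<^esub> translation k h"
        unfolding mult_Aut_Sym
        by (rule sym_hom_eqI[OF translation_closed sym_comp_closed
              [OF symmetric_simplicial_set_cell_sset translation_closed translation_closed]])
          (use gh in \<open>auto simp: translation_mult\<close>)
    qed
    show "bij_betw (translation k) (carrier H) (carrier ?A)"
      unfolding bij_betw_def
    proof
      show "inj_on (translation k) (carrier H)"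
        using translation_inj assms by (auto intro!: inj_onI)
      show "translation k ` carrier H = carrier ?A"
        using automorphism_is_translation[OF assms] translation_inverses by (fastforce simp: carrier)
    qed
  qed
  then have "H \<cong> ?A" by (auto simp: is_iso_def)
  then show ?thesis by (rule iso_sym)
qed

section \<open>Infinitely many isomorphism types over a fixed type\<close>

text \<open>The largest nondegenerate simplices have dimension \<open>2l + 1\<close> on one side and \<open>2k + 1\<close> on the
  other.\<close>

lemma cells_not_isomorphic:
  assumes "3 \<le> k" "k < l"
  shows "\<not> sym_isomorphic (cell_sset (cells l)) (cell_sset (cells k))"
proof
  assume "sym_isomorphic (cell_sset (cells l)) (cell_sset (cells k))"
  then obtain \<alpha> \<beta> where inv: "sym_inverses (cell_sset (cells l)) (cell_sset (cells k)) \<alpha> \<beta>"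
    by (auto simp: sym_isomorphic_iff symmetric_simplicial_set_cell_sset)
  have "mult_cell l \<one> \<one> (\<one> \<otimes> \<one>) \<in> faces (cells l) (2 * l + 1)"
    by (intro cell_in_faces mult_cell_in_cells) auto
  from faces_iso[OF inv this]
  obtain N s q where cell: "(N, s) \<in> cells k" and q: "inj_on q {..2 * l + 1}" "\<forall>i\<le>2 * l + 1. q i \<le> N"
    by (auto simp: faces_def)
  have "card {..2 * l + 1} \<le> card {..N}"
    using q by (intro card_inj_on_le) auto
  moreover have "N \<le> 2 * k + 1"
    using cell assms(1) by (cases rule: cells_cases) auto
  ultimately show False using assms(2) by simp
qed

text \<open>The cells are indexed by two sets of pairs of group elements, and \<open>'a + nat\<close> is infinite, hence as
  large as its square.\<close>

lemma small_model:
  "\<exists>Y :: ('a + nat) sym_sset. symmetric_simplicial_set Y \<and> sym_isomorphic (cell_sset (cells k)) Y"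
proof -
  let ?T = "UNIV :: ('a + nat) set"
  have inf: "infinite ?T" by (simp add: finite_Plus_UNIV_iff)
  have "|carrier H| \<le>o |?T|"
    by (rule card_of_ordLeqI[of Inl]) auto
  then have sq: "|carrier H \<times> carrier H| \<le>o |?T|"
    using inf by (intro card_of_Sigma_ordLeq_infinite) auto
  have "r \<subseteq> carrier H \<times> carrier H" using r_in_carrier by auto
  then have "|r| \<le>o |?T|" using sq by (metis card_of_mono1 ordLeq_transitive)
  then have "|cells k| \<le>o |?T|"
    unfolding cells_def using sq inf
    by (intro card_of_Un_ordLeq_infinite_Field ordLeq_transitive[OF card_of_image])
      (simp_all add: Field_card_of card_of_card_order_on)
  then have "|simplices (cell_sset (cells k)) n| \<le>o |?T|" for n
    by (rule cell_sset_small[OF inf])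
  then have "\<exists>e. inj_on e (simplices (cell_sset (cells k)) n) \<and>
      e ` simplices (cell_sset (cells k)) n \<subseteq> ?T" for n
    by (simp only: card_of_ordLeq)
  then obtain e :: "nat \<Rightarrow> _ \<Rightarrow> 'a + nat" where "inj_on (e n) (simplices (cell_sset (cells k)) n)" for n
    by metis
  then show ?thesis
    by (rule transport_simplices[OF symmetric_simplicial_set_cell_sset])
qed

end

theorem corollary2:
  fixes H :: "('g, 'm) monoid_scheme"
  assumes "group H"
  shows "(\<exists>X :: ('g + nat) sym_sset. symmetric_simplicial_set X \<and> Aut_Sym X \<cong> H) \<and>
    (\<exists>\<X> :: ('g + nat) sym_sset set. infinite \<X> \<and>
       (\<forall>X\<in>\<X>. symmetric_simplicial_set X \<and> Aut_Sym X \<cong> H) \<and>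
       pairwise (\<lambda>X Y. \<not> sym_isomorphic X Y) \<X>)"
proof -
  obtain r where "well_order_on (carrier H) r" using well_order_on by blast
  then interpret well_ordered_group H r
    using assms by (simp add: well_ordered_group_def well_ordered_group_axioms_def)
  obtain Y :: "nat \<Rightarrow> ('g + nat) sym_sset"
    where Y: "symmetric_simplicial_set (Y k)" "sym_isomorphic (cell_sset (cells k)) (Y k)" for k
    using small_model by metis
  note X = symmetric_simplicial_set_cell_sset
  have Aut: "Aut_Sym (Y k) \<cong> H" if "k \<ge> 3" for k
    using Aut_Sym_cong[OF Y(1) X sym_isomorphic_sym[OF Y(2)]] Aut_cells[OF that]
    by (rule iso_trans)
  have distinct: "\<not> sym_isomorphic (Y k) (Y l)" if "k \<ge> 3" "l \<ge> 3" "k \<noteq> l" for k l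
  proof
    assume "sym_isomorphic (Y k) (Y l)"
    then have "sym_isomorphic (cell_sset (cells k)) (cell_sset (cells l))"
      using sym_isomorphic_trans[OF X Y(1) X sym_isomorphic_trans[OF X Y(1) Y(1) Y(2)]
          sym_isomorphic_sym[OF Y(2)]] by blast
    then show False
      using cells_not_isomorphic[of k l] cells_not_isomorphic[of l k] that sym_isomorphic_sym
      by (meson linorder_neqE_nat)
  qed
  have inj: "inj_on Y {3..}"
    using distinct sym_isomorphic_refl[OF Y(1)] by (metis atLeast_iff inj_onI)
  have "infinite (Y ` {3..})"
    using inj by (simp add: finite_image_iff infinite_Ici)
  moreover have "pairwise (\<lambda>X Y. \<not> sym_isomorphic X Y) (Y ` {3..})"
    using distinct by (auto simp: pairwise_def)
  moreover have "\<forall>X\<in>Y ` {3..}. symmetric_simplicial_set X \<and> Aut_Sym X \<cong> H"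
    using Y(1) Aut by auto
  ultimately show ?thesis
    using Y(1) Aut[of 3] by blast
qed

end
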